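(* Let $R$ be a ring, $\alpha$ an ordinal, and let $M$ be a weakly atomic right $R$-module which is an irredundant sum of submodules each of which has Noetherian dimension $\le\alpha$. Then $n\text{-}\dim M\le\alpha$.
   Context: Rings are associative with identity and modules are unital right modules. Ordinals are taken to begin with $-1$ (so $0$ is the successor of $-1$). Noetherian dimension (also called dual Krull dimension) $n\text{-}\dim M$: defined by transfinite recursion. $n\text{-}\dim M=-1$ iff $M=0$. For an ordinal $\alpha\ge 0$, $n\text{-}\dim M=\alpha$ iff $n\text{-}\dim M\not<\alpha$ and for every ascending chain $M_0\subseteq M_1\subseteq M_2\subseteq\cdots$ of submodules of $M$ there is $k$ with $n\text{-}\dim(M_{i+1}/M_i)<\alpha$ for all $i\ge k$. If no such ordinal exists, $M$ does not have Noetherian dimension. A sum $M=\sum_{\delta\in\Delta}M_\delta$ of submodules is irredundant if $M\ne\sum_{\delta\ne\delta_0}M_\delta$ for every $\delta_0\in\Delta$. A submodule $N$ of $M$ is small if for every submodule $L$ of $M$, $N+L=M$ implies $L=M$. A module $M$ (having Noetherian dimension) is weakly atomic if $n\text{-}\dim N<n\text{-}\dim M$ for every proper non-small submodule $N$ of $M$. *)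

theory Defs
  imports "HOL-Algebra.Algebra"
begin

text \<open>
  The library's locale \<^locale>\<open>module\<close> only covers commutative rings. Here the product \<open>x r\<close> of a
  right module is written \<open>r \<odot> x\<close>, so that the associativity law reads
  \<open>(x a) b = x (a b)\<close>.
\<close>

locale right_module = R?: ring R + M?: abelian_group M
  for R :: "('a, 'c) ring_scheme" (structure) and M :: "('a, 'b, 'm) module_scheme" (structure) +
  assumes smult_closed [simp, intro]:
      "\<lbrakk>a \<in> carrier R; x \<in> carrier M\<rbrakk> \<Longrightarrow> a \<odot>\<^bsub>M\<^esub> x \<in> carrier M"
    and smult_l_distr:
      "\<lbrakk>a \<in> carrier R; b \<in> carrier R; x \<in> carrier M\<rbrakk> \<Longrightarrow>
        (a \<oplus> b) \<odot>\<^bsub>M\<^esub> x = a \<odot>\<^bsub>M\<^esub> x \<oplus>\<^bsub>M\<^esub> b \<odot>\<^bsub>M\<^esub> x"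
    and smult_r_distr:
      "\<lbrakk>a \<in> carrier R; x \<in> carrier M; y \<in> carrier M\<rbrakk> \<Longrightarrow>
        a \<odot>\<^bsub>M\<^esub> (x \<oplus>\<^bsub>M\<^esub> y) = a \<odot>\<^bsub>M\<^esub> x \<oplus>\<^bsub>M\<^esub> a \<odot>\<^bsub>M\<^esub> y"
    and smult_assoc:
      "\<lbrakk>a \<in> carrier R; b \<in> carrier R; x \<in> carrier M\<rbrakk> \<Longrightarrow>
        (a \<otimes> b) \<odot>\<^bsub>M\<^esub> x = b \<odot>\<^bsub>M\<^esub> (a \<odot>\<^bsub>M\<^esub> x)"
    and smult_one [simp]:
      "x \<in> carrier M \<Longrightarrow> \<one> \<odot>\<^bsub>M\<^esub> x = x"

text \<open>
  The transfinite recursion below passes from a module to its subquotients, so these must have the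
  same type as the module itself. A submodule \<open>N\<close> is taken as the module \<open>sub_mod M N\<close>, and
  the quotient \<open>M / N\<close> is carried not by the cosets but by one chosen representative of
  each coset.
\<close>

definition sub_mod :: "('a, 'b, 'm) module_scheme \<Rightarrow> 'b set \<Rightarrow> ('a, 'b, 'm) module_scheme" where
  "sub_mod M N = M\<lparr>carrier := N\<rparr>"

definition coset_rep :: "('a, 'b, 'm) module_scheme \<Rightarrow> 'b set \<Rightarrow> 'b \<Rightarrow> 'b" where
  "coset_rep M N x = (SOME y. y \<in> N +>\<^bsub>M\<^esub> x)"

definition quot_mod :: "('a, 'b, 'm) module_scheme \<Rightarrow> 'b set \<Rightarrow> ('a, 'b, 'm) module_scheme" where
  "quot_mod M N = M\<lparr>carrier := coset_rep M N ` carrier M,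
     zero := coset_rep M N \<zero>\<^bsub>M\<^esub>,
     add := (\<lambda>x y. coset_rep M N (x \<oplus>\<^bsub>M\<^esub> y)),
     smult := (\<lambda>a x. coset_rep M N (a \<odot>\<^bsub>M\<^esub> x))\<rparr>"

text \<open>
  Ordinals are the elements of an arbitrary well-ordered type \<open>'o\<close>, that is, of an
  arbitrary initial segment of the ordinals. The least element of \<open>'o\<close> plays the role of
  the ordinal \<open>-1\<close>. The predicate \<open>has_ndim R \<alpha> M\<close> says that \<open>n-dim M = \<alpha>\<close>.
\<close>

function has_ndim ::
  "('a, 'c) ring_scheme \<Rightarrow> 'o::wellorder \<Rightarrow> ('a, 'b, 'm) module_scheme \<Rightarrow> bool" where
  "has_ndim R \<alpha> M \<longleftrightarrow>
    (if \<forall>\<beta>. \<alpha> \<le> \<beta> then carrier M = {\<zero>\<^bsub>M\<^esub>}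
     else \<not> (\<exists>\<beta>\<in>{..<\<alpha>}. has_ndim R \<beta> M) \<and>
       (\<forall>C :: nat \<Rightarrow> 'b set.
          (\<forall>i. submodule (C i) R M) \<and> (\<forall>i. C i \<subseteq> C (Suc i)) \<longrightarrow>
          (\<exists>k. \<forall>i\<ge>k. \<exists>\<beta>\<in>{..<\<alpha>}. has_ndim R \<beta> (quot_mod (sub_mod M (C (Suc i))) (C i)))))"
  by pat_completeness auto
termination
  by (relation "inv_image {(\<beta>, \<alpha>). \<beta> < \<alpha>} (\<lambda>(R, \<alpha>, M). \<alpha>)") (auto simp: wf)

declare has_ndim.simps [simp del]

definition ndim_le ::
  "('a, 'c) ring_scheme \<Rightarrow> ('a, 'b, 'm) module_scheme \<Rightarrow> 'o::wellorder \<Rightarrow> bool" where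
  "ndim_le R M \<alpha> \<longleftrightarrow> (\<exists>\<beta>\<le>\<alpha>. has_ndim R \<beta> M)"

definition small_submodule ::
  "('a, 'c) ring_scheme \<Rightarrow> ('a, 'b, 'm) module_scheme \<Rightarrow> 'b set \<Rightarrow> bool" where
  "small_submodule R M N \<longleftrightarrow> submodule N R M \<and>
    (\<forall>L. submodule L R M \<longrightarrow> N <+>\<^bsub>M\<^esub> L = carrier M \<longrightarrow> L = carrier M)"

text \<open>The type argument is the range of ordinals in which \<open>M\<close> has Noetherian dimension.\<close>

definition weakly_atomic ::
  "'o::wellorder itself \<Rightarrow> ('a, 'c) ring_scheme \<Rightarrow> ('a, 'b, 'm) module_scheme \<Rightarrow> bool" where
  "weakly_atomic _ R M \<longleftrightarrow>
    (\<exists>\<alpha>::'o. has_ndim R \<alpha> M \<and>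
      (\<forall>N. submodule N R M \<and> N \<noteq> carrier M \<and> \<not> small_submodule R M N \<longrightarrow>
        (\<exists>\<beta><\<alpha>. has_ndim R \<beta> (sub_mod M N))))"

definition submodule_sum ::
  "('a, 'b, 'm) module_scheme \<Rightarrow> 'i set \<Rightarrow> ('i \<Rightarrow> 'b set) \<Rightarrow> 'b set" where
  "submodule_sum M \<Delta> N =
    {finsum M x F | x F. finite F \<and> F \<subseteq> \<Delta> \<and> (\<forall>\<delta>\<in>F. x \<delta> \<in> N \<delta>)}"

definition irredundant_sum ::
  "('a, 'b, 'm) module_scheme \<Rightarrow> 'i set \<Rightarrow> ('i \<Rightarrow> 'b set) \<Rightarrow> bool" where
  "irredundant_sum M \<Delta> N \<longleftrightarrow> carrier M = submodule_sum M \<Delta> N \<and>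
    (\<forall>\<delta>\<^sub>0\<in>\<Delta>. carrier M \<noteq> submodule_sum M (\<Delta> - {\<delta>\<^sub>0}) N)"

lemma has_ndim_unique:
  fixes \<alpha> \<beta> :: "'o::wellorder"
  assumes "has_ndim R \<alpha> M" and "has_ndim R \<beta> M"
  shows "\<alpha> = \<beta>"
proof -
  have "\<not> \<beta>' < \<alpha>'" if "has_ndim R \<alpha>' M" "has_ndim R \<beta>' M" for \<alpha>' \<beta>' :: 'o
  proof
    assume "\<beta>' < \<alpha>'"
    then have "\<not> (\<forall>\<beta>. \<alpha>' \<le> \<beta>)" by (auto simp: not_le)
    with that(1) have "\<not> (\<exists>\<beta>\<in>{..<\<alpha>'}. has_ndim R \<beta> M)"
      by (subst (asm) has_ndim.simps) simp
    with that(2) \<open>\<beta>' < \<alpha>'\<close> show False by blast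
  qed
  with assms show ?thesis by (meson antisym_conv3)
qed

text \<open>
  The map \<open>coset_rep M N\<close> is the canonical projection from \<open>M\<close> onto \<open>M / N\<close>: it is compatible
  with the operations and identifies two elements precisely when their cosets agree.
\<close>

context right_module
begin

lemma submodule_imp_abelian_subgroup:
  assumes "submodule N R M"
  shows "abelian_subgroup N M"
  using assms by (intro abelian_subgroupI3 additive_subgroup.intro) 
    (auto simp: submodule_def M.abelian_group_axioms)

lemma coset_rep_mem:
  assumes "submodule N R M" "x \<in> carrier M"
  shows "coset_rep M N x \<in> N +>\<^bsub>M\<^esub> x"
proof -
  interpret abelian_subgroup N M using assms(1) by (rule submodule_imp_abelian_subgroup)
  show ?thesis unfolding coset_rep_def
    by (rule someI) (use assms(2) in \<open>rule a_rcos_self\<close>)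
qed

lemma coset_rep_closed:
  assumes "submodule N R M" "x \<in> carrier M"
  shows "coset_rep M N x \<in> carrier M"
proof -
  interpret abelian_subgroup N M using assms(1) by (rule submodule_imp_abelian_subgroup)
  show ?thesis using coset_rep_mem[OF assms] a_r_coset_subset_G[OF a_subset assms(2)] by blast
qed

lemma coset_coset_rep:
  assumes "submodule N R M" "x \<in> carrier M"
  shows "N +>\<^bsub>M\<^esub> coset_rep M N x = N +>\<^bsub>M\<^esub> x"
proof -
  interpret abelian_subgroup N M using assms(1) by (rule submodule_imp_abelian_subgroup)
  show ?thesis using a_repr_independence[OF coset_rep_mem[OF assms] assms(2)] a_subgroup by simp
qed

lemma coset_rep_eq_iff:
  assumes "submodule N R M" "x \<in> carrier M" "y \<in> carrier M"
  shows "coset_rep M N x = coset_rep M N y \<longleftrightarrow> N +>\<^bsub>M\<^esub> x = N +>\<^bsub>M\<^esub> y"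
  using coset_coset_rep[OF assms(1,2)] coset_coset_rep[OF assms(1,3)]
  by (metis coset_rep_def)

lemma coset_rep_add:
  assumes N: "submodule N R M" and x: "x \<in> carrier M" and y: "y \<in> carrier M"
  shows "coset_rep M N (x \<oplus>\<^bsub>M\<^esub> y) =
    coset_rep M N x \<oplus>\<^bsub>quot_mod M N\<^esub> coset_rep M N y"
proof -
  interpret abelian_subgroup N M using N by (rule submodule_imp_abelian_subgroup)
  have "N +>\<^bsub>M\<^esub> (x \<oplus>\<^bsub>M\<^esub> y) = N +>\<^bsub>M\<^esub> (coset_rep M N x \<oplus>\<^bsub>M\<^esub> coset_rep M N y)"
    using a_rcos_sum x y coset_rep_closed[OF N] coset_coset_rep[OF N] by metis
  then show ?thesis
    using coset_rep_eq_iff[OF N] coset_rep_closed[OF N] x y by (simp add: quot_mod_def)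
qed

lemma coset_rep_smult:
  assumes N: "submodule N R M" and a: "a \<in> carrier R" and x: "x \<in> carrier M"
  shows "coset_rep M N (a \<odot>\<^bsub>M\<^esub> x) = a \<odot>\<^bsub>quot_mod M N\<^esub> coset_rep M N x"
proof -
  interpret abelian_subgroup N M using N by (rule submodule_imp_abelian_subgroup)
  obtain n where n: "n \<in> N" "coset_rep M N x = n \<oplus>\<^bsub>M\<^esub> x"
    using coset_rep_mem[OF N x] by (auto simp: a_r_coset_def')
  have an: "a \<odot>\<^bsub>M\<^esub> n \<in> N" using submodule.smult_closed[OF N a n(1)] .
  have nM: "n \<in> carrier M" using n(1) a_subset by blast
  have "a \<odot>\<^bsub>M\<^esub> coset_rep M N x = a \<odot>\<^bsub>M\<^esub> n \<oplus>\<^bsub>M\<^esub> a \<odot>\<^bsub>M\<^esub> x"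
    using n(2) smult_r_distr[OF a nM x] by simp
  then have "a \<odot>\<^bsub>M\<^esub> coset_rep M N x \<in> N +>\<^bsub>M\<^esub> (a \<odot>\<^bsub>M\<^esub> x)"
    using an by (auto simp: a_r_coset_def')
  then have "N +>\<^bsub>M\<^esub> (a \<odot>\<^bsub>M\<^esub> x) = N +>\<^bsub>M\<^esub> (a \<odot>\<^bsub>M\<^esub> coset_rep M N x)"
    using a_repr_independence a_subgroup a x by blast
  then show ?thesis
    using coset_rep_eq_iff[OF N] coset_rep_closed[OF N] a x by (simp add: quot_mod_def)
qed

end

end

theory Submission
  imports Defs
begin

text \<open>
  The Noetherian dimension of a sum \<open>A + B\<close> of two submodules is the larger of those of \<open>A\<close> and
  \<open>B\<close>. Hence a weakly atomic module \<open>M\<close> is not a sum of two proper submodules: from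
  \<open>A + B = M\<close> with both proper, neither is small, so both have smaller dimension than \<open>M\<close>, and
  then so has \<open>A + B\<close> (\<open>weakly_atomic_summand_trivial\<close>). In an irredundant sum, pick any summand
  \<open>N\<^sub>\<delta>\<close>; the sum of the others is proper, so \<open>N\<^sub>\<delta> = M\<close>, and the bound on the dimension of
  \<open>N\<^sub>\<delta>\<close> is the claim. The empty sum is the zero module.

  The work lies in the dimension of \<open>A + B\<close>. Recursion through quotient modules makes the
  dimension hard to compare between \<open>B / (A \<inter> B)\<close> and \<open>(A + B) / A\<close>, say, or between an iterated
  quotient and a single one. The bound \<open>n-dim (U / L) \<le> \<alpha>\<close> is therefore first replaced by a
  relation \<open>factor_dim_le\<close> that refers only to chains of submodules of \<open>M\<close> between \<open>L\<close> and \<open>U\<close>. For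
  that relation the sum bound is a matter of modular lattices: chains can be intersected with a
  submodule or added to one, and the modular law recovers the original chain
  (\<open>factor_dim_le_set_add\<close>, \<open>factor_dim_le_extension\<close>). The lattice correspondence along a
  surjection with kernel \<open>L\<close> shows that the relation agrees with the Noetherian dimension
  (\<open>ndim_le_iff_factor_dim_le\<close>).
\<close>

section \<open>Submodules of a right module\<close>

context right_module
begin

lemma smult_zero [simp]: "a \<in> carrier R \<Longrightarrow> a \<odot>\<^bsub>M\<^esub> \<zero>\<^bsub>M\<^esub> = \<zero>\<^bsub>M\<^esub>"
  by (metis M.add.l_cancel_one' M.add.m_closed M.zero_closed M.l_zero smult_closed smult_r_distr)

lemma zero_smult [simp]:
  assumes "x \<in> carrier M"
  shows "\<zero> \<odot>\<^bsub>M\<^esub> x = \<zero>\<^bsub>M\<^esub>"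
proof -
  have "\<zero> \<odot>\<^bsub>M\<^esub> x \<oplus>\<^bsub>M\<^esub> \<zero> \<odot>\<^bsub>M\<^esub> x = \<zero> \<odot>\<^bsub>M\<^esub> x"
    using smult_l_distr[of \<zero> \<zero> x] assms by simp
  then show ?thesis
    using assms by (metis M.add.l_cancel_one' smult_closed R.zero_closed)
qed

lemma smult_minus_one:
  assumes "x \<in> carrier M"
  shows "(\<ominus> \<one>) \<odot>\<^bsub>M\<^esub> x = \<ominus>\<^bsub>M\<^esub> x"
proof -
  have "(\<ominus> \<one>) \<odot>\<^bsub>M\<^esub> x \<oplus>\<^bsub>M\<^esub> x = \<zero>\<^bsub>M\<^esub>"
    using smult_l_distr[of "\<ominus> \<one>" \<one> x] assms by (simp add: R.l_neg)
  then show ?thesis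
    using assms by (metis M.minus_equality R.a_inv_closed R.one_closed smult_closed)
qed

text \<open>
  Closure under negatives is absent from the right-hand side because \<open>- x\<close> is the multiple of
  \<open>x\<close> by \<open>- 1\<close>.
\<close>

lemma submodule_iff:
  "submodule H R M \<longleftrightarrow> H \<subseteq> carrier M \<and> \<zero>\<^bsub>M\<^esub> \<in> H \<and>
    (\<forall>x\<in>H. \<forall>y\<in>H. x \<oplus>\<^bsub>M\<^esub> y \<in> H) \<and> (\<forall>a\<in>carrier R. \<forall>x\<in>H. a \<odot>\<^bsub>M\<^esub> x \<in> H)"
  (is "_ \<longleftrightarrow> ?closed")
proof
  assume "submodule H R M"
  then show ?closed
    by (auto simp: submodule_def submodule_axioms_def subgroup_def)
next
  assume c: ?closed
  have "inv\<^bsub>add_monoid M\<^esub> x \<in> H" if "x \<in> H" for x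
    using c that smult_minus_one[of x] by (metis R.a_inv_closed R.one_closed a_inv_def subsetD)
  with c show "submodule H R M"
    by (auto simp: submodule_def submodule_axioms_def subgroup_def)
qed

lemma submodule_carrier: "submodule (carrier M) R M"
  by (simp add: submodule_iff)

lemma submodule_zero: "submodule {\<zero>\<^bsub>M\<^esub>} R M"
  by (simp add: submodule_iff)

lemma submodule_Int: "submodule A R M \<Longrightarrow> submodule B R M \<Longrightarrow> submodule (A \<inter> B) R M"
  by (auto simp: submodule_iff)

lemma submodule_set_add:
  assumes A: "submodule A R M" and B: "submodule B R M"
  shows "submodule (A <+>\<^bsub>M\<^esub> B) R M"
proof -
  have sub: "A \<subseteq> carrier M" "B \<subseteq> carrier M" and zero: "\<zero>\<^bsub>M\<^esub> \<in> A" "\<zero>\<^bsub>M\<^esub> \<in> B"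
    using A B by (auto simp: submodule_iff)
  have mem: "x \<oplus>\<^bsub>M\<^esub> y \<in> A <+>\<^bsub>M\<^esub> B" if "x \<in> A" "y \<in> B" for x y
    using that by (auto simp: set_add_def')
  have zero': "\<zero>\<^bsub>M\<^esub> \<in> A <+>\<^bsub>M\<^esub> B" using mem[OF zero] by simp
  have add: "(x \<oplus>\<^bsub>M\<^esub> y) \<oplus>\<^bsub>M\<^esub> (x' \<oplus>\<^bsub>M\<^esub> y') \<in> A <+>\<^bsub>M\<^esub> B"
    if "x \<in> A" "y \<in> B" "x' \<in> A" "y' \<in> B" for x y x' y'
  proof -
    have "(x \<oplus>\<^bsub>M\<^esub> y) \<oplus>\<^bsub>M\<^esub> (x' \<oplus>\<^bsub>M\<^esub> y') = (x \<oplus>\<^bsub>M\<^esub> x') \<oplus>\<^bsub>M\<^esub> (y \<oplus>\<^bsub>M\<^esub> y')"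
      using that sub by (simp add: M.a_ac subset_eq)
    moreover have "x \<oplus>\<^bsub>M\<^esub> x' \<in> A" "y \<oplus>\<^bsub>M\<^esub> y' \<in> B"
      using that A B by (auto simp: submodule_iff)
    ultimately show ?thesis using mem by simp
  qed
  have smult: "a \<odot>\<^bsub>M\<^esub> (x \<oplus>\<^bsub>M\<^esub> y) \<in> A <+>\<^bsub>M\<^esub> B"
    if "a \<in> carrier R" "x \<in> A" "y \<in> B" for a x y
  proof -
    have "a \<odot>\<^bsub>M\<^esub> x \<in> A" "a \<odot>\<^bsub>M\<^esub> y \<in> B"
      using that A B by (auto simp: submodule_iff)
    then show ?thesis using mem that sub smult_r_distr[of a x y] by (simp add: subset_eq)
  qed
  show ?thesis
    unfolding submodule_iff using zero' add smult sub
    by (auto simp: set_add_def' subset_eq)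
qed

lemma set_add_upper1:
  assumes "submodule A R M" "submodule B R M"
  shows "A \<subseteq> A <+>\<^bsub>M\<^esub> B"
proof
  fix x assume "x \<in> A"
  then have "x = x \<oplus>\<^bsub>M\<^esub> \<zero>\<^bsub>M\<^esub>" "\<zero>\<^bsub>M\<^esub> \<in> B"
    using assms by (auto simp: submodule_iff)
  with \<open>x \<in> A\<close> show "x \<in> A <+>\<^bsub>M\<^esub> B" unfolding set_add_def' by blast
qed

lemma set_add_upper2:
  assumes "submodule A R M" "submodule B R M"
  shows "B \<subseteq> A <+>\<^bsub>M\<^esub> B"
proof
  fix x assume "x \<in> B"
  then have "x = \<zero>\<^bsub>M\<^esub> \<oplus>\<^bsub>M\<^esub> x" "\<zero>\<^bsub>M\<^esub> \<in> A"
    using assms by (auto simp: submodule_iff)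
  with \<open>x \<in> B\<close> show "x \<in> A <+>\<^bsub>M\<^esub> B" unfolding set_add_def' by blast
qed

lemma set_add_commute:
  assumes "submodule A R M" "submodule B R M"
  shows "A <+>\<^bsub>M\<^esub> B = B <+>\<^bsub>M\<^esub> A"
proof -
  have "x \<oplus>\<^bsub>M\<^esub> y = y \<oplus>\<^bsub>M\<^esub> x" if "x \<in> A" "y \<in> B" for x y
    using that assms by (auto simp: submodule_iff intro!: M.a_comm)
  then show ?thesis unfolding set_add_def' by (auto; metis)
qed

lemma set_add_least:
  assumes "submodule C R M" "A \<subseteq> C" "B \<subseteq> C"
  shows "A <+>\<^bsub>M\<^esub> B \<subseteq> C"
  using assms by (auto simp: set_add_def' submodule_iff subset_eq)

lemma set_add_mono: "A \<subseteq> A' \<Longrightarrow> A <+>\<^bsub>M\<^esub> B \<subseteq> A' <+>\<^bsub>M\<^esub> B"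
  by (auto simp: set_add_def')

lemma modular_law:
  assumes C: "submodule C R M" and U: "submodule U R M" and Z: "submodule Z R M" and ZC: "Z \<subseteq> C"
  shows "C \<inter> (U <+>\<^bsub>M\<^esub> Z) = (C \<inter> U) <+>\<^bsub>M\<^esub> Z"
proof (intro equalityI subsetI)
  fix c assume "c \<in> C \<inter> (U <+>\<^bsub>M\<^esub> Z)"
  then obtain y z where yz: "y \<in> U" "z \<in> Z" "c = y \<oplus>\<^bsub>M\<^esub> z" and c: "c \<in> C"
    by (auto simp: set_add_def')
  have cl: "y \<in> carrier M" "z \<in> carrier M" using yz U Z by (auto simp: submodule_iff)
  have "(\<ominus> \<one>) \<odot>\<^bsub>M\<^esub> z \<in> C" using C ZC yz(2) by (auto simp: submodule_iff)
  then have "\<ominus>\<^bsub>M\<^esub> z \<in> C" using smult_minus_one cl by simp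
  then have "c \<oplus>\<^bsub>M\<^esub> \<ominus>\<^bsub>M\<^esub> z \<in> C" using C c by (auto simp: submodule_iff)
  moreover have "c \<oplus>\<^bsub>M\<^esub> \<ominus>\<^bsub>M\<^esub> z = y" using yz(3) cl by (simp add: M.a_assoc M.r_neg)
  ultimately show "c \<in> (C \<inter> U) <+>\<^bsub>M\<^esub> Z" using yz by (auto simp: set_add_def')
next
  fix c assume "c \<in> (C \<inter> U) <+>\<^bsub>M\<^esub> Z"
  then obtain y z where "y \<in> U" "y \<in> C" "z \<in> Z" "c = y \<oplus>\<^bsub>M\<^esub> z"
    by (auto simp: set_add_def')
  moreover from this have "c \<in> C" using C ZC by (auto simp: submodule_iff)
  ultimately show "c \<in> C \<inter> (U <+>\<^bsub>M\<^esub> Z)" by (auto simp: set_add_def')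
qed

text \<open>
  In a modular lattice, comparable elements with a common relative complement coincide. This is the
  step of dimension \<open>-1\<close> in \<open>factor_dim_le_extension\<close>: it says that \<open>U / L\<close> vanishes once its
  parts inside and outside \<open>Z\<close> do.
\<close>

lemma eq_if_Int_eq_set_add_eq:
  assumes L: "submodule L R M" and U: "submodule U R M" and Z: "submodule Z R M"
    and "L \<subseteq> U" and Int: "L \<inter> Z = U \<inter> Z" and Add: "L <+>\<^bsub>M\<^esub> Z = U <+>\<^bsub>M\<^esub> Z"
  shows "L = U"
proof -
  have "U = U \<inter> (Z <+>\<^bsub>M\<^esub> L)"
    using set_add_upper1[OF U Z] Add set_add_commute[OF L Z] by auto
  also have "\<dots> = (U \<inter> Z) <+>\<^bsub>M\<^esub> L" using modular_law[OF U Z L \<open>L \<subseteq> U\<close>] .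
  also have "\<dots> \<subseteq> L" using Int by (intro set_add_least[OF L]) auto
  finally show ?thesis using \<open>L \<subseteq> U\<close> by simp
qed

lemma submodule_finsum_mem:
  assumes N: "submodule N R M" and "finite F" "\<And>i. i \<in> F \<Longrightarrow> x i \<in> N"
  shows "finsum M x F \<in> N"
  using assms(2,3)
proof (induction F)
  case empty
  show ?case using N by (simp add: submodule_iff)
next
  case (insert i F)
  have sub: "N \<subseteq> carrier M" using N by (simp add: submodule_iff)
  then have "finsum M x (insert i F) = x i \<oplus>\<^bsub>M\<^esub> finsum M x F"
    using insert by (intro M.finsum_insert) auto
  with insert N show ?case by (simp add: submodule_iff)
qed

lemma finsum_smult:
  assumes a: "a \<in> carrier R" and "finite F" "\<And>i. i \<in> F \<Longrightarrow> x i \<in> carrier M"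
  shows "a \<odot>\<^bsub>M\<^esub> finsum M x F = finsum M (\<lambda>i. a \<odot>\<^bsub>M\<^esub> x i) F"
  using assms(2,3)
proof (induction F)
  case (insert i F)
  then have "finsum M x (insert i F) = x i \<oplus>\<^bsub>M\<^esub> finsum M x F"
    "finsum M (\<lambda>i. a \<odot>\<^bsub>M\<^esub> x i) (insert i F) = a \<odot>\<^bsub>M\<^esub> x i \<oplus>\<^bsub>M\<^esub> finsum M (\<lambda>i. a \<odot>\<^bsub>M\<^esub> x i) F"
    using a by (auto intro!: M.finsum_insert)
  moreover have "finsum M x F \<in> carrier M" using insert by (intro M.finsum_closed) auto
  ultimately show ?case using insert a by (simp add: smult_r_distr)
qed (use a in simp)

text \<open>
  Two finite sums are added over the union of their index sets, after padding both families of
  summands with zeros.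
\<close>

lemma submodule_submodule_sum:
  assumes N: "\<And>\<delta>. \<delta> \<in> \<Delta> \<Longrightarrow> submodule (N \<delta>) R M"
  shows "submodule (submodule_sum M \<Delta> N) R M"
proof -
  have sub: "x \<in> carrier M" if "\<delta> \<in> \<Delta>" "x \<in> N \<delta>" for x \<delta>
    using N[OF that(1)] that(2) by (auto simp: submodule_iff)
  have "finsum M x F \<in> carrier M" if "F \<subseteq> \<Delta>" "\<forall>\<delta>\<in>F. x \<delta> \<in> N \<delta>" for x F
    using that sub by (intro M.finsum_closed) blast
  moreover have "\<zero>\<^bsub>M\<^esub> \<in> submodule_sum M \<Delta> N"
    unfolding submodule_sum_def by (intro CollectI exI[of _ "\<lambda>_. \<zero>\<^bsub>M\<^esub>"] exI[of _ "{}"]) auto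
  moreover have "finsum M x F \<oplus>\<^bsub>M\<^esub> finsum M y G \<in> submodule_sum M \<Delta> N"
    if F: "finite F" "F \<subseteq> \<Delta>" "\<forall>\<delta>\<in>F. x \<delta> \<in> N \<delta>" and G: "finite G" "G \<subseteq> \<Delta>" "\<forall>\<delta>\<in>G. y \<delta> \<in> N \<delta>"
    for x y F G
  proof -
    let ?x = "\<lambda>\<delta>. if \<delta> \<in> F then x \<delta> else \<zero>\<^bsub>M\<^esub>" and ?y = "\<lambda>\<delta>. if \<delta> \<in> G then y \<delta> else \<zero>\<^bsub>M\<^esub>"
    have x: "?x \<delta> \<in> N \<delta>" "?x \<delta> \<in> carrier M" and y: "?y \<delta> \<in> N \<delta>" "?y \<delta> \<in> carrier M"
      if "\<delta> \<in> F \<union> G" for \<delta>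
      using that F G N[of \<delta>] sub[of \<delta>] by (auto simp: submodule_iff)
    have "finsum M x F = finsum M ?x (F \<union> G)"
      using F G sub by (intro M.add.finprod_mono_neutral_cong_left) auto
    moreover have "finsum M y G = finsum M ?y (F \<union> G)"
      using F G sub by (intro M.add.finprod_mono_neutral_cong_left) auto
    ultimately have "finsum M x F \<oplus>\<^bsub>M\<^esub> finsum M y G = finsum M (\<lambda>\<delta>. ?x \<delta> \<oplus>\<^bsub>M\<^esub> ?y \<delta>) (F \<union> G)"
      using x y by (subst M.finsum_addf) auto
    moreover have "\<forall>\<delta>\<in>F \<union> G. ?x \<delta> \<oplus>\<^bsub>M\<^esub> ?y \<delta> \<in> N \<delta>"
    proof
      fix \<delta> assume \<delta>: "\<delta> \<in> F \<union> G"
      then have "\<delta> \<in> \<Delta>" using F G by auto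
      from N[OF this] x(1)[OF \<delta>] y(1)[OF \<delta>] show "?x \<delta> \<oplus>\<^bsub>M\<^esub> ?y \<delta> \<in> N \<delta>"
        unfolding submodule_iff by blast
    qed
    ultimately show ?thesis
      unfolding submodule_sum_def using F G
      by (intro CollectI exI[of _ "\<lambda>\<delta>. ?x \<delta> \<oplus>\<^bsub>M\<^esub> ?y \<delta>"] exI[of _ "F \<union> G"]) auto
  qed
  moreover have "a \<odot>\<^bsub>M\<^esub> finsum M x F \<in> submodule_sum M \<Delta> N"
    if F: "finite F" "F \<subseteq> \<Delta>" "\<forall>\<delta>\<in>F. x \<delta> \<in> N \<delta>" and a: "a \<in> carrier R" for x F a
  proof -
    have "a \<odot>\<^bsub>M\<^esub> finsum M x F = finsum M (\<lambda>\<delta>. a \<odot>\<^bsub>M\<^esub> x \<delta>) F"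
      using F sub by (intro finsum_smult[OF a]) auto
    moreover have "\<forall>\<delta>\<in>F. a \<odot>\<^bsub>M\<^esub> x \<delta> \<in> N \<delta>"
      using F N a by (meson subsetD submodule_iff)
    ultimately show ?thesis using F unfolding submodule_sum_def by blast
  qed
  ultimately show ?thesis
    unfolding submodule_iff by (auto simp: submodule_sum_def)
qed

lemma submodule_sum_remove:
  assumes N: "\<And>\<delta>. \<delta> \<in> \<Delta> \<Longrightarrow> submodule (N \<delta>) R M" and d: "d \<in> \<Delta>"
  shows "submodule_sum M \<Delta> N \<subseteq> N d <+>\<^bsub>M\<^esub> submodule_sum M (\<Delta> - {d}) N"
proof
  fix s assume "s \<in> submodule_sum M \<Delta> N"
  then obtain x F where F: "finite F" "F \<subseteq> \<Delta>" "\<forall>\<delta>\<in>F. x \<delta> \<in> N \<delta>" and s: "s = finsum M x F"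
    unfolding submodule_sum_def by blast
  have sub: "x \<delta> \<in> carrier M" if "\<delta> \<in> F" for \<delta>
  proof -
    have "\<delta> \<in> \<Delta>" "x \<delta> \<in> N \<delta>" using F that by auto
    then show ?thesis using N[of \<delta>] by (auto simp: submodule_iff)
  qed
  have rest: "finsum M x (F - {d}) \<in> submodule_sum M (\<Delta> - {d}) N"
    unfolding submodule_sum_def using F
    by (intro CollectI exI[of _ x] exI[of _ "F - {d}"]) auto
  show "s \<in> N d <+>\<^bsub>M\<^esub> submodule_sum M (\<Delta> - {d}) N"
  proof (cases "d \<in> F")
    case True
    have "finsum M x (insert d (F - {d})) = x d \<oplus>\<^bsub>M\<^esub> finsum M x (F - {d})"
      using F True sub by (intro M.finsum_insert) auto
    then have "s = x d \<oplus>\<^bsub>M\<^esub> finsum M x (F - {d})"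
      using s True by (simp add: insert_absorb)
    then show ?thesis using rest F True by (auto simp: set_add_def')
  next
    case False
    have "submodule (submodule_sum M (\<Delta> - {d}) N) R M"
      using N by (intro submodule_submodule_sum) auto
    then show ?thesis
      using rest s False set_add_upper2[OF N[OF d]] by auto
  qed
qed

end

section \<open>The dimension of a factor as an order-theoretic rank\<close>

definition submodule_chain where
  "submodule_chain R M L U C \<longleftrightarrow>
    (\<forall>i::nat. submodule (C i) R M \<and> C i \<subseteq> C (Suc i) \<and> L \<subseteq> C i \<and> C i \<subseteq> U)"

text \<open>
  The intended meaning of \<open>factor_dim_le R M \<alpha> L U\<close> is \<open>n-dim (U / L) \<le> \<alpha>\<close>. Bounding the
  dimension, instead of fixing its value, makes the recursion positive, hence an inductive
  definition. The least ordinal, which stands for \<open>-1\<close>, gets no case of its own: the second rule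
  cannot apply to it when \<open>L \<subseteq> U\<close> are submodules, since a constant chain would need a smaller ordinal.
\<close>

inductive factor_dim_le ::
  "('a, 'c) ring_scheme \<Rightarrow> ('a, 'b, 'm) module_scheme \<Rightarrow> 'o::wellorder \<Rightarrow> 'b set \<Rightarrow> 'b set \<Rightarrow> bool"
  for R M where
  trivial: "factor_dim_le R M \<alpha> L L"
| chain: "(\<forall>C. submodule_chain R M L U C \<longrightarrow>
      (\<exists>k. \<forall>i\<ge>k. \<exists>\<beta><\<alpha>. factor_dim_le R M \<beta> (C i) (C (Suc i))))
    \<Longrightarrow> factor_dim_le R M \<alpha> L U"

lemma factor_dim_le_mono:
  assumes "factor_dim_le R M \<alpha> L U" "\<alpha> \<le> \<beta>"
  shows "factor_dim_le R M \<beta> L U"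
  using assms(1)
proof cases
  case chain
  then show ?thesis
    using assms(2) by (intro factor_dim_le.chain) (meson less_le_trans)
qed (simp add: factor_dim_le.trivial)

text \<open>
  A nonzero factor has dimension greater than \<open>-1\<close>. The smaller ordinal obtained here is what
  allows zero factors of a chain to count as having dimension below \<open>\<alpha>\<close>.
\<close>

lemma factor_dim_le_nontrivial:
  fixes \<alpha> :: "'o::wellorder"
  assumes "factor_dim_le R M \<alpha> L U" "L \<noteq> U" "submodule U R M" "L \<subseteq> U"
  obtains \<beta>\<^sub>0 :: 'o where "\<beta>\<^sub>0 < \<alpha>"
  using assms(1)
proof cases
  case chain
  have "submodule_chain R M L U (\<lambda>_. U)" using assms by (simp add: submodule_chain_def)
  with chain that show ?thesis by blast
qed (use assms in simp)

text \<open>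
  The existence of some \<open>\<beta>\<^sub>0 < \<alpha>\<close> makes the chain condition available for \<open>L = U\<close> as well,
  where every factor is zero. Thus the proofs below need not ask which rule gave the bound.
\<close>

lemma factor_dim_le_chainD:
  fixes \<alpha> :: "'o::wellorder"
  assumes "factor_dim_le R M \<alpha> L U" "\<beta>\<^sub>0 < \<alpha>" "submodule_chain R M L U C"
  shows "\<exists>k. \<forall>i\<ge>k. \<exists>\<beta><\<alpha>. factor_dim_le R M \<beta> (C i) (C (Suc i))"
  using assms(1)
proof cases
  case trivial
  then have "C i = L" for i using assms(3) by (auto simp: submodule_chain_def)
  then show ?thesis using assms(2) by (auto intro: factor_dim_le.trivial)
next
  case chain
  with assms(3) show ?thesis by blast
qed

context right_module
begin

text \<open>
  The factor \<open>(U + Z) / (L + Z)\<close> is a quotient of \<open>U / L\<close>. A chain \<open>C\<^sub>i\<close> between \<open>L + Z\<close> and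
  \<open>U + Z\<close> is cut down to the chain \<open>C\<^sub>i \<inter> U\<close> between \<open>L\<close> and \<open>U\<close>, and the modular law gives it
  back: \<open>(C\<^sub>i \<inter> U) + Z = C\<^sub>i\<close>. So the induction hypothesis, applied to the factors of the smaller
  chain, bounds those of \<open>C\<^sub>i\<close>.
\<close>

lemma factor_dim_le_set_add:
  fixes \<alpha> :: "'o::wellorder"
  assumes "factor_dim_le R M \<alpha> L U"
    and "submodule L R M" "submodule U R M" "submodule Z R M" "L \<subseteq> U"
  shows "factor_dim_le R M \<alpha> (L <+>\<^bsub>M\<^esub> Z) (U <+>\<^bsub>M\<^esub> Z)"
  using assms
proof (induction \<alpha> arbitrary: L U rule: less_induct)
  case (less \<alpha>)
  note L = less.prems(2) and U = less.prems(3) and Z = less.prems(4)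
  show ?case
  proof (cases "L = U")
    case True
    then show ?thesis by (simp add: factor_dim_le.trivial)
  next
    case False
    then obtain \<beta>\<^sub>0 where \<beta>\<^sub>0: "\<beta>\<^sub>0 < \<alpha>"
      using less.prems(1,3,5) factor_dim_le_nontrivial by blast
    show ?thesis
    proof (intro factor_dim_le.chain allI impI)
      fix C assume chain: "submodule_chain R M (L <+>\<^bsub>M\<^esub> Z) (U <+>\<^bsub>M\<^esub> Z) C"
      have C: "submodule (C i) R M" "C i \<subseteq> C (Suc i)" "L <+>\<^bsub>M\<^esub> Z \<subseteq> C i" "C i \<subseteq> U <+>\<^bsub>M\<^esub> Z" for i
        using chain by (auto simp: submodule_chain_def)
      have LC: "L \<subseteq> C i" and ZC: "Z \<subseteq> C i" for i
        using C(3)[of i] set_add_upper1[OF L Z] set_add_upper2[OF L Z] by auto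
      have "submodule_chain R M L U (\<lambda>i. C i \<inter> U)"
        using C(1,2) LC less.prems(5) U by (auto simp: submodule_chain_def submodule_Int)
      then obtain k where k: "\<And>i. i \<ge> k \<Longrightarrow> \<exists>\<beta><\<alpha>. factor_dim_le R M \<beta> (C i \<inter> U) (C (Suc i) \<inter> U)"
        using factor_dim_le_chainD[OF less.prems(1) \<beta>\<^sub>0] by blast
      have eq: "(C i \<inter> U) <+>\<^bsub>M\<^esub> Z = C i" for i
        using modular_law[OF C(1) U Z ZC] C(4) by blast
      show "\<exists>k. \<forall>i\<ge>k. \<exists>\<beta><\<alpha>. factor_dim_le R M \<beta> (C i) (C (Suc i))"
      proof (intro exI[of _ k] allI impI)
        fix i assume "i \<ge> k"
        then obtain \<beta> where \<beta>: "\<beta> < \<alpha>" "factor_dim_le R M \<beta> (C i \<inter> U) (C (Suc i) \<inter> U)"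
          using k by blast
        have "factor_dim_le R M \<beta> ((C i \<inter> U) <+>\<^bsub>M\<^esub> Z) ((C (Suc i) \<inter> U) <+>\<^bsub>M\<^esub> Z)"
          using less.IH[OF \<beta>] C(1,2) U Z submodule_Int by blast
        with \<beta>(1) show "\<exists>\<beta><\<alpha>. factor_dim_le R M \<beta> (C i) (C (Suc i))" by (auto simp: eq)
      qed
    qed
  qed
qed

text \<open>
  The factor \<open>U / L\<close> is an extension of \<open>(U + Z) / (L + Z)\<close> by \<open>(U \<inter> Z) / (L \<inter> Z)\<close>. A chain
  between \<open>L\<close> and \<open>U\<close> gives one in each of the two by intersecting with \<open>Z\<close> and by adding \<open>Z\<close>.
  From some index on the factors of both have dimension below \<open>\<alpha>\<close>, and as the same construction
  decomposes each factor \<open>C\<^sub>i\<^sub>+\<^sub>1 / C\<^sub>i\<close>, the induction hypothesis applies to the maximum of the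
  two bounds.
\<close>

lemma factor_dim_le_extension:
  fixes \<alpha> :: "'o::wellorder"
  assumes "factor_dim_le R M \<alpha> (L \<inter> Z) (U \<inter> Z)"
    and "factor_dim_le R M \<alpha> (L <+>\<^bsub>M\<^esub> Z) (U <+>\<^bsub>M\<^esub> Z)"
    and "submodule L R M" "submodule U R M" "submodule Z R M" "L \<subseteq> U"
  shows "factor_dim_le R M \<alpha> L U"
  using assms
proof (induction \<alpha> arbitrary: L U rule: less_induct)
  case (less \<alpha>)
  note L = less.prems(3) and U = less.prems(4) and Z = less.prems(5) and LU = less.prems(6)
  show ?case
  proof (cases "L = U")
    case True
    then show ?thesis by (simp add: factor_dim_le.trivial)
  next
    case False
    then consider "L \<inter> Z \<noteq> U \<inter> Z" | "L <+>\<^bsub>M\<^esub> Z \<noteq> U <+>\<^bsub>M\<^esub> Z"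
      using eq_if_Int_eq_set_add_eq[OF L U Z LU] by blast
    then obtain \<beta>\<^sub>0 where \<beta>\<^sub>0: "\<beta>\<^sub>0 < \<alpha>"
    proof cases
      case 1
      then show ?thesis
        using factor_dim_le_nontrivial[OF less.prems(1)] that U Z LU submodule_Int by blast
    next
      case 2
      then show ?thesis
        using factor_dim_le_nontrivial[OF less.prems(2)] that submodule_set_add[OF U Z]
          set_add_mono[OF LU] by blast
    qed
    show ?thesis
    proof (intro factor_dim_le.chain allI impI)
      fix C assume chain: "submodule_chain R M L U C"
      have C: "submodule (C i) R M" "C i \<subseteq> C (Suc i)" "L \<subseteq> C i" "C i \<subseteq> U" for i
        using chain by (auto simp: submodule_chain_def)
      have "submodule_chain R M (L \<inter> Z) (U \<inter> Z) (\<lambda>i. C i \<inter> Z)"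
        unfolding submodule_chain_def
        by (intro allI conjI submodule_Int C Z Int_mono order.refl)
      then obtain k where k: "\<And>i. i \<ge> k \<Longrightarrow> \<exists>\<beta><\<alpha>. factor_dim_le R M \<beta> (C i \<inter> Z) (C (Suc i) \<inter> Z)"
        using factor_dim_le_chainD[OF less.prems(1) \<beta>\<^sub>0] by blast
      have "submodule_chain R M (L <+>\<^bsub>M\<^esub> Z) (U <+>\<^bsub>M\<^esub> Z) (\<lambda>i. C i <+>\<^bsub>M\<^esub> Z)"
        using C Z unfolding submodule_chain_def by (simp add: submodule_set_add set_add_mono)
      then obtain l where l: "\<And>i. i \<ge> l \<Longrightarrow>
          \<exists>\<beta><\<alpha>. factor_dim_le R M \<beta> (C i <+>\<^bsub>M\<^esub> Z) (C (Suc i) <+>\<^bsub>M\<^esub> Z)"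
        using factor_dim_le_chainD[OF less.prems(2) \<beta>\<^sub>0] by blast
      show "\<exists>k. \<forall>i\<ge>k. \<exists>\<beta><\<alpha>. factor_dim_le R M \<beta> (C i) (C (Suc i))"
      proof (intro exI[of _ "max k l"] allI impI)
        fix i assume i: "i \<ge> max k l"
        obtain \<beta> where \<beta>: "\<beta> < \<alpha>" "factor_dim_le R M \<beta> (C i \<inter> Z) (C (Suc i) \<inter> Z)"
          using k[of i] i by auto
        obtain \<gamma> where \<gamma>: "\<gamma> < \<alpha>" "factor_dim_le R M \<gamma> (C i <+>\<^bsub>M\<^esub> Z) (C (Suc i) <+>\<^bsub>M\<^esub> Z)"
          using l[of i] i by auto
        have "max \<beta> \<gamma> < \<alpha>" using \<beta> \<gamma> by simp
        moreover have "factor_dim_le R M (max \<beta> \<gamma>) (C i) (C (Suc i))"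
        proof (rule less.IH[OF \<open>max \<beta> \<gamma> < \<alpha>\<close> _ _ C(1) C(1) Z C(2)])
          show "factor_dim_le R M (max \<beta> \<gamma>) (C i \<inter> Z) (C (Suc i) \<inter> Z)"
            using \<beta>(2) by (rule factor_dim_le_mono) simp
          show "factor_dim_le R M (max \<beta> \<gamma>) (C i <+>\<^bsub>M\<^esub> Z) (C (Suc i) <+>\<^bsub>M\<^esub> Z)"
            using \<gamma>(2) by (rule factor_dim_le_mono) simp
        qed
        ultimately show "\<exists>\<beta><\<alpha>. factor_dim_le R M \<beta> (C i) (C (Suc i))" by blast
      qed
    qed
  qed
qed

text \<open>
  With \<open>Z = A\<close> the sum \<open>A + B\<close> is an extension of \<open>(A + B) / A\<close>, a quotient of \<open>B\<close>, by \<open>A\<close>.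
\<close>

lemma factor_dim_le_sum:
  fixes \<alpha> :: "'o::wellorder"
  assumes A: "submodule A R M" and B: "submodule B R M"
    and dA: "factor_dim_le R M \<alpha> {\<zero>\<^bsub>M\<^esub>} A" and dB: "factor_dim_le R M \<alpha> {\<zero>\<^bsub>M\<^esub>} B"
  shows "factor_dim_le R M \<alpha> {\<zero>\<^bsub>M\<^esub>} (A <+>\<^bsub>M\<^esub> B)"
proof (rule factor_dim_le_extension[where Z = A])
  have zero: "\<zero>\<^bsub>M\<^esub> \<in> A" "\<zero>\<^bsub>M\<^esub> \<in> B" using A B by (auto simp: submodule_iff)
  note AB = submodule_set_add[OF A B]
  show zAB: "{\<zero>\<^bsub>M\<^esub>} \<subseteq> A <+>\<^bsub>M\<^esub> B" using AB by (simp add: submodule_iff)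
  show "factor_dim_le R M \<alpha> ({\<zero>\<^bsub>M\<^esub>} \<inter> A) ((A <+>\<^bsub>M\<^esub> B) \<inter> A)"
    using dA zero set_add_upper1[OF A B] by (simp add: Int_absorb1 Int_absorb2)
  have "(A <+>\<^bsub>M\<^esub> B) <+>\<^bsub>M\<^esub> A = A <+>\<^bsub>M\<^esub> B"
    using set_add_least[OF AB order.refl set_add_upper1[OF A B]] set_add_upper1[OF AB A] by blast
  then have "(A <+>\<^bsub>M\<^esub> B) <+>\<^bsub>M\<^esub> A = B <+>\<^bsub>M\<^esub> A" using set_add_commute[OF A B] by simp
  then show "factor_dim_le R M \<alpha> ({\<zero>\<^bsub>M\<^esub>} <+>\<^bsub>M\<^esub> A) ((A <+>\<^bsub>M\<^esub> B) <+>\<^bsub>M\<^esub> A)"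
    using factor_dim_le_set_add[OF dB submodule_zero B A] zero by simp
qed (use A B submodule_zero submodule_set_add in auto)

end

section \<open>Comparison with the Noetherian dimension\<close>

text \<open>
  The map \<open>f\<close> exhibits \<open>Q\<close> as \<open>U / L\<close>. Nothing is assumed of \<open>Q\<close> beyond its operations;
  the module laws are inherited from \<open>M\<close>. In this way one notion covers quotients, submodules and
  quotients of submodules of quotients alike, however their elements are represented.
\<close>

definition subquotient_map where
  "subquotient_map R M L U Q f \<longleftrightarrow>
    submodule L R M \<and> submodule U R M \<and> L \<subseteq> U \<and> f ` U = carrier Q \<and>
    (\<forall>x\<in>U. \<forall>y\<in>U. f (x \<oplus>\<^bsub>M\<^esub> y) = f x \<oplus>\<^bsub>Q\<^esub> f y) \<and>
    (\<forall>a\<in>carrier R. \<forall>x\<in>U. f (a \<odot>\<^bsub>M\<^esub> x) = a \<odot>\<^bsub>Q\<^esub> f x) \<and>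
    (\<forall>x\<in>U. f x = \<zero>\<^bsub>Q\<^esub> \<longleftrightarrow> x \<in> L)"

context right_module
begin

lemma right_module_sub_mod:
  assumes N: "submodule N R M"
  shows "right_module R (sub_mod M N)"
proof -
  have sub: "\<And>x. x \<in> N \<Longrightarrow> x \<in> carrier M" using N by (auto simp: submodule_iff)
  have inv: "\<exists>y\<in>N. y \<oplus>\<^bsub>M\<^esub> x = \<zero>\<^bsub>M\<^esub>" if "x \<in> N" for x
  proof
    show "(\<ominus> \<one>) \<odot>\<^bsub>M\<^esub> x \<in> N" using that N by (auto simp: submodule_iff)
    show "(\<ominus> \<one>) \<odot>\<^bsub>M\<^esub> x \<oplus>\<^bsub>M\<^esub> x = \<zero>\<^bsub>M\<^esub>"
      using smult_minus_one sub that by (simp add: M.l_neg)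
  qed
  have "abelian_group (sub_mod M N)"
    using N sub inv by (intro abelian_groupI) (auto simp: sub_mod_def submodule_iff M.a_ac)
  moreover have "right_module_axioms R (sub_mod M N)"
    using N sub unfolding right_module_axioms_def
    by (auto simp: sub_mod_def submodule_iff smult_l_distr smult_r_distr smult_assoc)
  ultimately show ?thesis by (simp add: right_module_def R.ring_axioms)
qed

lemma submodule_sub_mod_iff:
  assumes "submodule N R M"
  shows "submodule K R (sub_mod M N) \<longleftrightarrow> submodule K R M \<and> K \<subseteq> N"
proof -
  interpret S: right_module R "sub_mod M N" using right_module_sub_mod[OF assms] .
  show ?thesis
    unfolding S.submodule_iff submodule_iff using assms
    by (auto simp: sub_mod_def submodule_iff)
qed

lemma coset_rep_eq_zero_iff:
  assumes N: "submodule N R M" and x: "x \<in> carrier M"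
  shows "coset_rep M N x = \<zero>\<^bsub>quot_mod M N\<^esub> \<longleftrightarrow> x \<in> N"
proof -
  interpret abelian_subgroup N M using N by (rule submodule_imp_abelian_subgroup)
  have "coset_rep M N x = \<zero>\<^bsub>quot_mod M N\<^esub> \<longleftrightarrow> N +>\<^bsub>M\<^esub> x = N"
    using coset_rep_eq_iff[OF N x M.zero_closed] M.a_coset_add_zero[OF a_subset]
    by (simp add: quot_mod_def)
  also have "\<dots> \<longleftrightarrow> x \<in> N" using a_rcos_self[OF x] a_rcos_const by auto
  finally show ?thesis .
qed

text \<open>
  The module laws hold in \<open>Q\<close> because it is the image of a module under a map that respects the
  operations.
\<close>

lemma right_module_subquotient:
  assumes f: "subquotient_map R M L U Q f"
  shows "right_module R Q"
proof -
  have L: "submodule L R M" and U: "submodule U R M" and img: "carrier Q = f ` U"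
    and add: "\<And>x y. x \<in> U \<Longrightarrow> y \<in> U \<Longrightarrow> f x \<oplus>\<^bsub>Q\<^esub> f y = f (x \<oplus>\<^bsub>M\<^esub> y)"
    and smult: "\<And>a x. a \<in> carrier R \<Longrightarrow> x \<in> U \<Longrightarrow> a \<odot>\<^bsub>Q\<^esub> f x = f (a \<odot>\<^bsub>M\<^esub> x)"
    and ker: "\<And>x. x \<in> U \<Longrightarrow> f x = \<zero>\<^bsub>Q\<^esub> \<longleftrightarrow> x \<in> L"
    using f by (auto simp: subquotient_map_def)
  have UM: "\<And>x. x \<in> U \<Longrightarrow> x \<in> carrier M" and UI:  "\<zero>\<^bsub>M\<^esub> \<in> U"
    "\<And>x y. x \<in> U \<Longrightarrow> y \<in> U \<Longrightarrow> x \<oplus>\<^bsub>M\<^esub> y \<in> U"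
    "\<And>a x. a \<in> carrier R \<Longrightarrow> x \<in> U \<Longrightarrow> a \<odot>\<^bsub>M\<^esub> x \<in> U"
    using U by (auto simp: submodule_iff)
  have zero: "\<zero>\<^bsub>Q\<^esub> = f \<zero>\<^bsub>M\<^esub>" using ker[OF UI(1)] L by (simp add: submodule_iff)
  have inv: "\<exists>y\<in>U. f y \<oplus>\<^bsub>Q\<^esub> f x = f \<zero>\<^bsub>M\<^esub>" if "x \<in> U" for x
  proof
    show "(\<ominus> \<one>) \<odot>\<^bsub>M\<^esub> x \<in> U" using that UI by simp
    then show "f ((\<ominus> \<one>) \<odot>\<^bsub>M\<^esub> x) \<oplus>\<^bsub>Q\<^esub> f x = f \<zero>\<^bsub>M\<^esub>"
      using that UM by (simp add: add smult_minus_one M.l_neg)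
  qed
  have "abelian_group Q"
    using UM UI inv by (intro abelian_groupI) (auto simp: img zero add M.a_ac)
  moreover have "right_module_axioms R Q"
    using UM UI unfolding right_module_axioms_def
    by (auto simp: img add smult smult_l_distr smult_r_distr smult_assoc)
  ultimately show ?thesis by (simp add: right_module_def R.ring_axioms)
qed

lemma submodule_image_subquotient:
  assumes f: "subquotient_map R M L U Q f" and C: "submodule C R M" "C \<subseteq> U"
  shows "submodule (f ` C) R Q"
proof -
  interpret Q: right_module R Q using right_module_subquotient[OF f] .
  have "\<zero>\<^bsub>M\<^esub> \<in> C" "f \<zero>\<^bsub>M\<^esub> = \<zero>\<^bsub>Q\<^esub>"
    using f C by (auto simp: subquotient_map_def submodule_iff)
  then have "\<zero>\<^bsub>Q\<^esub> \<in> f ` C" by (metis imageI)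
  then show ?thesis
    unfolding Q.submodule_iff using f C
    by (auto simp: subquotient_map_def submodule_iff subset_eq simp flip: ball_simps(9))
      (metis image_eqI)+
qed

lemma submodule_vimage_subquotient:
  assumes f: "subquotient_map R M L U Q f" and D: "submodule D R Q"
  shows "submodule {y \<in> U. f y \<in> D} R M" "L \<subseteq> {y \<in> U. f y \<in> D}" "f ` {y \<in> U. f y \<in> D} = D"
proof -
  interpret Q: right_module R Q using right_module_subquotient[OF f] .
  have f0: "\<And>x. x \<in> L \<Longrightarrow> f x = \<zero>\<^bsub>Q\<^esub>" "L \<subseteq> U" "\<zero>\<^bsub>M\<^esub> \<in> L"
    using f by (auto simp: subquotient_map_def submodule_iff)
  then show "L \<subseteq> {y \<in> U. f y \<in> D}" using D by (auto simp: Q.submodule_iff)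
  show "submodule {y \<in> U. f y \<in> D} R M"
    using f D f0 by (auto simp: subquotient_map_def submodule_iff Q.submodule_iff subset_eq)
  show "f ` {y \<in> U. f y \<in> D} = D"
    using f D by (auto simp: subquotient_map_def Q.submodule_iff)
qed

text \<open>
  A submodule containing the kernel is the full preimage of its image, as \<open>f y = f c\<close> puts \<open>y - c\<close>
  into \<open>L \<subseteq> C\<close>.
\<close>

lemma vimage_image_subquotient:
  assumes f: "subquotient_map R M L U Q f" and C: "submodule C R M" "L \<subseteq> C" "C \<subseteq> U"
    and y: "y \<in> U" "f y \<in> f ` C"
  shows "y \<in> C"
proof -
  interpret Q: right_module R Q using right_module_subquotient[OF f] .
  have U: "submodule U R M" and L: "submodule L R M" using f by (auto simp: subquotient_map_def)
  obtain c where c: "c \<in> C" "f y = f c" using y by auto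
  have cl: "y \<in> carrier M" "c \<in> carrier M" "c \<in> U" using U y c C by (auto simp: submodule_iff)
  let ?d = "(\<ominus> \<one>) \<odot>\<^bsub>M\<^esub> c"
  have d: "?d \<in> C" "?d \<in> U" using C U c cl by (auto simp: submodule_iff)
  have "f (y \<oplus>\<^bsub>M\<^esub> ?d) = f y \<oplus>\<^bsub>Q\<^esub> f ?d" "f (c \<oplus>\<^bsub>M\<^esub> ?d) = f c \<oplus>\<^bsub>Q\<^esub> f ?d"
    using f y cl d by (auto simp: subquotient_map_def)
  moreover have "c \<oplus>\<^bsub>M\<^esub> ?d = \<zero>\<^bsub>M\<^esub>" using cl by (simp add: smult_minus_one M.r_neg)
  moreover have "f \<zero>\<^bsub>M\<^esub> = \<zero>\<^bsub>Q\<^esub>"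
    using f L U by (auto simp: subquotient_map_def submodule_iff)
  ultimately have "f (y \<oplus>\<^bsub>M\<^esub> ?d) = \<zero>\<^bsub>Q\<^esub>" using c by simp
  moreover have "y \<oplus>\<^bsub>M\<^esub> ?d \<in> U" using U y d by (auto simp: submodule_iff)
  ultimately have "y \<oplus>\<^bsub>M\<^esub> ?d \<in> C" using f C by (auto simp: subquotient_map_def)
  then have "(y \<oplus>\<^bsub>M\<^esub> ?d) \<oplus>\<^bsub>M\<^esub> c \<in> C" using C c by (auto simp: submodule_iff)
  moreover have "(y \<oplus>\<^bsub>M\<^esub> ?d) \<oplus>\<^bsub>M\<^esub> c = y"
    using cl by (simp add: smult_minus_one M.a_assoc M.l_neg)
  ultimately show ?thesis by simp
qed

text \<open>
  The third isomorphism theorem in the form needed for recursion: a factor of submodules of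
  \<open>Q\<close>, which the Noetherian dimension of \<open>Q\<close> refers to, is a factor of submodules of \<open>M\<close>.
\<close>

lemma subquotient_map_quot_mod:
  assumes f: "subquotient_map R M L U Q f"
    and C: "submodule C R M" "submodule C' R M" "L \<subseteq> C" "C \<subseteq> C'" "C' \<subseteq> U"
  shows "subquotient_map R M C C' (quot_mod (sub_mod Q (f ` C')) (f ` C))
    (coset_rep (sub_mod Q (f ` C')) (f ` C) \<circ> f)"
proof -
  interpret Q: right_module R Q using right_module_subquotient[OF f] .
  have D': "submodule (f ` C') R Q" and D: "submodule (f ` C) R Q"
    using submodule_image_subquotient[OF f] C by auto
  let ?S = "sub_mod Q (f ` C')"
  interpret S: right_module R ?S using Q.right_module_sub_mod[OF D'] .
  have DS: "submodule (f ` C) R ?S"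
    using Q.submodule_sub_mod_iff[OF D'] D C by auto
  have S: "carrier ?S = f ` C'" "\<And>x y. x \<oplus>\<^bsub>?S\<^esub> y = x \<oplus>\<^bsub>Q\<^esub> y" "\<And>a x. a \<odot>\<^bsub>?S\<^esub> x = a \<odot>\<^bsub>Q\<^esub> x"
    by (auto simp: sub_mod_def)
  have C'U: "x \<in> U" if "x \<in> C'" for x using that C(5) by blast
  have fadd: "f (x \<oplus>\<^bsub>M\<^esub> y) = f x \<oplus>\<^bsub>Q\<^esub> f y" if "x \<in> C'" "y \<in> C'" for x y
    using f C'U[OF that(1)] C'U[OF that(2)] unfolding subquotient_map_def by blast
  have fsmult: "f (a \<odot>\<^bsub>M\<^esub> x) = a \<odot>\<^bsub>Q\<^esub> f x" if "a \<in> carrier R" "x \<in> C'" for a x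
    using f that(1) C'U[OF that(2)] unfolding subquotient_map_def by blast
  have ker: "f x \<in> f ` C \<longleftrightarrow> x \<in> C" if "x \<in> C'" for x
    using vimage_image_subquotient[OF f C(1) C(3)] that C by blast
  show ?thesis
    unfolding subquotient_map_def
  proof (intro conjI ballI)
    show "(coset_rep ?S (f ` C) \<circ> f) ` C' = carrier (quot_mod ?S (f ` C))"
      by (simp add: quot_mod_def S image_comp)
  next
    fix x y assume "x \<in> C'" "y \<in> C'"
    then show "(coset_rep ?S (f ` C) \<circ> f) (x \<oplus>\<^bsub>M\<^esub> y) =
      (coset_rep ?S (f ` C) \<circ> f) x \<oplus>\<^bsub>quot_mod ?S (f ` C)\<^esub> (coset_rep ?S (f ` C) \<circ> f) y"
      using S.coset_rep_add[OF DS, of "f x" "f y"] by (simp add: S fadd)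
  next
    fix a x assume "a \<in> carrier R" "x \<in> C'"
    then show "(coset_rep ?S (f ` C) \<circ> f) (a \<odot>\<^bsub>M\<^esub> x) =
      a \<odot>\<^bsub>quot_mod ?S (f ` C)\<^esub> (coset_rep ?S (f ` C) \<circ> f) x"
      using S.coset_rep_smult[OF DS, of a "f x"] by (simp add: S fsmult)
  next
    fix x assume "x \<in> C'"
    then show "(coset_rep ?S (f ` C) \<circ> f) x = \<zero>\<^bsub>quot_mod ?S (f ` C)\<^esub> \<longleftrightarrow> x \<in> C"
      using S.coset_rep_eq_zero_iff[OF DS, of "f x"] ker by (simp add: S)
  qed (use C in auto)
qed

text \<open>
  The clause of \<open>has_ndim\<close> that excludes smaller values disappears when only a bound is asked for:
  the chain condition for an ordinal implies it for every larger one.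
\<close>

lemma ndim_le_iff:
  fixes \<alpha> :: "'o::wellorder"
  shows "ndim_le R M \<alpha> \<longleftrightarrow> carrier M = {\<zero>\<^bsub>M\<^esub>} \<or>
    (\<forall>C. submodule_chain R M {\<zero>\<^bsub>M\<^esub>} (carrier M) C \<longrightarrow>
      (\<exists>k. \<forall>i\<ge>k. \<exists>\<beta><\<alpha>. ndim_le R (quot_mod (sub_mod M (C (Suc i))) (C i)) \<beta>))"
    (is "_ \<longleftrightarrow> _ \<or> ?chain \<alpha>")
proof -
  have chain_iff: "submodule_chain R M {\<zero>\<^bsub>M\<^esub>} (carrier M) C \<longleftrightarrow>
      (\<forall>i. submodule (C i) R M) \<and> (\<forall>i. C i \<subseteq> C (Suc i))" for C
    by (auto simp: submodule_chain_def submodule_iff)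
  have less_iff: "(\<exists>\<beta>\<in>{..<\<gamma>}. has_ndim R \<beta> K) \<longleftrightarrow> (\<exists>\<beta><\<gamma>. ndim_le R K \<beta>)"
    for \<gamma> :: 'o and K :: "('a, 'b, 'd) module_scheme"
    unfolding ndim_le_def by (auto intro: le_less_trans)
  have has_iff: "has_ndim R \<gamma> M \<longleftrightarrow> (if \<forall>\<beta>. \<gamma> \<le> \<beta> then carrier M = {\<zero>\<^bsub>M\<^esub>}
      else \<not> (\<exists>\<beta><\<gamma>. ndim_le R M \<beta>) \<and> ?chain \<gamma>)" for \<gamma> :: 'o
    by (subst has_ndim.simps) (simp only: less_iff chain_iff)
  show ?thesis
  proof
    assume "ndim_le R M \<alpha>"
    then obtain \<gamma> where \<gamma>: "\<gamma> \<le> \<alpha>" "has_ndim R \<gamma> M" by (auto simp: ndim_le_def)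
    show "carrier M = {\<zero>\<^bsub>M\<^esub>} \<or> ?chain \<alpha>"
    proof (cases "\<forall>\<beta>. \<gamma> \<le> \<beta>")
      case True
      then show ?thesis using \<gamma>(2) unfolding has_iff by simp
    next
      case False
      then have "?chain \<gamma>" using \<gamma>(2) unfolding has_iff by simp
      then show ?thesis using \<gamma>(1) less_le_trans by meson
    qed
  next
    assume A: "carrier M = {\<zero>\<^bsub>M\<^esub>} \<or> ?chain \<alpha>"
    show "ndim_le R M \<alpha>"
    proof (cases "carrier M = {\<zero>\<^bsub>M\<^esub>}")
      case True
      \<comment> \<open>The least element of the type stands for the dimension \<open>-1\<close> of the zero module.\<close>
      have "\<forall>\<beta>. (LEAST \<beta>::'o. True) \<le> \<beta>" by (simp add: Least_le)
      then show ?thesis unfolding ndim_le_def using True has_iff by metis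
    next
      case False
      with A have ch: "?chain \<alpha>" by simp
      have "submodule_chain R M {\<zero>\<^bsub>M\<^esub>} (carrier M) (\<lambda>_. carrier M)"
        by (simp add: submodule_chain_def submodule_carrier)
      \<comment> \<open>The factors of this constant chain already require an ordinal below \<open>\<alpha>\<close>.\<close>
      with ch have "\<exists>\<beta>. \<beta> < \<alpha>" by blast
      then have nb: "\<not> (\<forall>\<beta>. \<alpha> \<le> \<beta>)" by (auto simp: not_le)
      show ?thesis
      proof (cases "\<exists>\<beta><\<alpha>. ndim_le R M \<beta>")
        case True
        then show ?thesis unfolding ndim_le_def by (meson le_less_trans less_imp_le)
      next
        case False
        then have "has_ndim R \<alpha> M" unfolding has_iff if_not_P[OF nb] using ch by (rule conjI)
        then show ?thesis unfolding ndim_le_def by blast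
      qed
    qed
  qed
qed

end

text \<open>
  Images and preimages under \<open>f\<close> match the chains in \<open>Q\<close> with those between \<open>L\<close> and \<open>U\<close>. The
  factors of matching chains are again related by a surjection as in \<open>subquotient_map_quot_mod\<close>,
  so the induction has to range over all \<open>L\<close>, \<open>U\<close>, \<open>Q\<close> and \<open>f\<close>.
\<close>

lemma ndim_le_iff_factor_dim_le:
  fixes \<alpha> :: "'o::wellorder"
  assumes M: "right_module R M" and f: "subquotient_map R M L U Q f"
  shows "ndim_le R Q \<alpha> \<longleftrightarrow> factor_dim_le R M \<alpha> L U"
  using f
proof (induction \<alpha> arbitrary: L U Q f rule: less_induct)
  case (less \<alpha>)
  interpret right_module R M by (rule M)
  note f = less.prems
  interpret Q: right_module R Q using right_module_subquotient[OF f] .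
  have LU: "L \<subseteq> U" "submodule L R M" "submodule U R M" "f ` U = carrier Q"
    using f by (auto simp: subquotient_map_def)
  have zero_iff: "carrier Q = {\<zero>\<^bsub>Q\<^esub>} \<longleftrightarrow> L = U"
  proof
    assume "carrier Q = {\<zero>\<^bsub>Q\<^esub>}"
    then have "f y = \<zero>\<^bsub>Q\<^esub>" if "y \<in> U" for y using f that by (auto simp: subquotient_map_def)
    then show "L = U" using f by (auto simp: subquotient_map_def)
  next
    assume "L = U"
    then have "f y = \<zero>\<^bsub>Q\<^esub>" if "y \<in> U" for y using f that by (auto simp: subquotient_map_def)
    then show "carrier Q = {\<zero>\<^bsub>Q\<^esub>}" using LU(4) Q.zero_closed by auto
  qed
  have factor: "(\<exists>\<beta><\<alpha>. ndim_le R (quot_mod (sub_mod Q (f ` C (Suc i))) (f ` C i)) \<beta>) \<longleftrightarrow>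
      (\<exists>\<beta><\<alpha>. factor_dim_le R M \<beta> (C i) (C (Suc i)))"
    if "submodule_chain R M L U C" for C and i :: nat
    using that less.IH[OF _ subquotient_map_quot_mod[OF f, of "C i" "C (Suc i)"]]
    unfolding submodule_chain_def by blast
  have image: "submodule_chain R Q {\<zero>\<^bsub>Q\<^esub>} (carrier Q) (\<lambda>i. f ` C i)"
    if "submodule_chain R M L U C" for C
  proof -
    have C: "submodule (C i) R M" "C i \<subseteq> U" "C i \<subseteq> C (Suc i)" for i
      using that by (auto simp: submodule_chain_def)
    have "submodule (f ` C i) R Q" "f ` C i \<subseteq> f ` C (Suc i)" for i
      using submodule_image_subquotient[OF f C(1,2)] C(3) by (auto intro: image_mono)
    then show ?thesis by (auto simp: submodule_chain_def Q.submodule_iff)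
  qed
  have vimage: "\<exists>C. submodule_chain R M L U C \<and> D = (\<lambda>i. f ` C i)"
    if "submodule_chain R Q {\<zero>\<^bsub>Q\<^esub>} (carrier Q) D" for D
  proof (intro exI conjI)
    let ?C = "\<lambda>i. {y \<in> U. f y \<in> D i}"
    have D: "submodule (D i) R Q" "D i \<subseteq> D (Suc i)" for i
      using that by (auto simp: submodule_chain_def)
    show "D = (\<lambda>i. f ` ?C i)"
      using submodule_vimage_subquotient(3)[OF f D(1)] by simp
    show "submodule_chain R M L U ?C"
      unfolding submodule_chain_def
      using submodule_vimage_subquotient(1,2)[OF f D(1)] D(2) by blast
  qed
  have "(\<forall>D. submodule_chain R Q {\<zero>\<^bsub>Q\<^esub>} (carrier Q) D \<longrightarrow>
      (\<exists>k. \<forall>i\<ge>k. \<exists>\<beta><\<alpha>. ndim_le R (quot_mod (sub_mod Q (D (Suc i))) (D i)) \<beta>)) \<longleftrightarrow>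
    (\<forall>C. submodule_chain R M L U C \<longrightarrow>
      (\<exists>k. \<forall>i\<ge>k. \<exists>\<beta><\<alpha>. ndim_le R (quot_mod (sub_mod Q (f ` C (Suc i))) (f ` C i)) \<beta>))"
    (is "?lhs \<longleftrightarrow> ?rhs")
  proof
    assume ?lhs
    then show ?rhs using image by blast
  next
    assume rhs: ?rhs
    show ?lhs
    proof (intro allI impI)
      fix D assume "submodule_chain R Q {\<zero>\<^bsub>Q\<^esub>} (carrier Q) D"
      then obtain C where C: "submodule_chain R M L U C" "D = (\<lambda>i. f ` C i)" using vimage by blast
      show "\<exists>k. \<forall>i\<ge>k. \<exists>\<beta><\<alpha>. ndim_le R (quot_mod (sub_mod Q (D (Suc i))) (D i)) \<beta>"
        using rhs C(1) unfolding C(2) by blast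
    qed
  qed
  then have "ndim_le R Q \<alpha> \<longleftrightarrow> L = U \<or> (\<forall>C. submodule_chain R M L U C \<longrightarrow>
      (\<exists>k. \<forall>i\<ge>k. \<exists>\<beta><\<alpha>. factor_dim_le R M \<beta> (C i) (C (Suc i))))"
    unfolding Q.ndim_le_iff[of \<alpha>] zero_iff using factor by (simp cong: imp_cong)
  then show ?case by (subst factor_dim_le.simps) auto
qed

context right_module
begin

lemma ndim_le_sub_mod_iff:
  fixes \<alpha> :: "'o::wellorder"
  assumes N: "submodule N R M"
  shows "ndim_le R (sub_mod M N) \<alpha> \<longleftrightarrow> factor_dim_le R M \<alpha> {\<zero>\<^bsub>M\<^esub>} N"
proof (rule ndim_le_iff_factor_dim_le)
  show "right_module R M" ..
  show "subquotient_map R M {\<zero>\<^bsub>M\<^esub>} N (sub_mod M N) id"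
    using N submodule_zero by (auto simp: subquotient_map_def sub_mod_def submodule_iff)
qed

lemma ndim_le_set_add:
  fixes \<alpha> :: "'o::wellorder"
  assumes "submodule A R M" "submodule B R M"
    and "ndim_le R (sub_mod M A) \<alpha>" "ndim_le R (sub_mod M B) \<alpha>"
  shows "ndim_le R (sub_mod M (A <+>\<^bsub>M\<^esub> B)) \<alpha>"
  using assms factor_dim_le_sum by (simp add: ndim_le_sub_mod_iff submodule_set_add)

text \<open>
  If both summands were proper, each would witness that the other is not small, so both would
  have smaller dimension than \<open>M\<close>, and so would their sum \<open>M\<close>.
\<close>

lemma weakly_atomic_summand_trivial:
  assumes atomic: "weakly_atomic TYPE('o::wellorder) R M"
    and A: "submodule A R M" and B: "submodule B R M" and AB: "A <+>\<^bsub>M\<^esub> B = carrier M"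
  shows "A = carrier M \<or> B = carrier M"
proof (rule ccontr)
  assume proper: "\<not> (A = carrier M \<or> B = carrier M)"
  obtain \<gamma> :: 'o where \<gamma>: "has_ndim R \<gamma> M"
    and lower: "\<And>N. submodule N R M \<Longrightarrow> N \<noteq> carrier M \<Longrightarrow> \<not> small_submodule R M N \<Longrightarrow>
      \<exists>\<beta><\<gamma>. has_ndim R \<beta> (sub_mod M N)"
    using atomic unfolding weakly_atomic_def by blast
  have "\<not> small_submodule R M A" using AB B proper by (auto simp: small_submodule_def)
  then obtain \<beta>\<^sub>1 where \<beta>\<^sub>1: "\<beta>\<^sub>1 < \<gamma>" "has_ndim R \<beta>\<^sub>1 (sub_mod M A)" using lower A proper by blast
  have "\<not> small_submodule R M B"
    using AB set_add_commute[OF A B] A proper by (auto simp: small_submodule_def)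
  then obtain \<beta>\<^sub>2 where \<beta>\<^sub>2: "\<beta>\<^sub>2 < \<gamma>" "has_ndim R \<beta>\<^sub>2 (sub_mod M B)" using lower B proper by blast
  have "ndim_le R (sub_mod M A) (max \<beta>\<^sub>1 \<beta>\<^sub>2)" "ndim_le R (sub_mod M B) (max \<beta>\<^sub>1 \<beta>\<^sub>2)"
    using \<beta>\<^sub>1(2) \<beta>\<^sub>2(2) unfolding ndim_le_def by (meson max.cobounded1 max.cobounded2)+
  then have "ndim_le R M (max \<beta>\<^sub>1 \<beta>\<^sub>2)"
    using ndim_le_set_add[OF A B] AB by (simp add: sub_mod_def)
  then obtain \<beta> where "\<beta> \<le> max \<beta>\<^sub>1 \<beta>\<^sub>2" "has_ndim R \<beta> M" by (auto simp: ndim_le_def)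
  then show False using has_ndim_unique[OF \<gamma>] \<beta>\<^sub>1(1) \<beta>\<^sub>2(1) by (auto simp: max_def split: if_splits)
qed

end

theorem proposition2p6:
  fixes R :: "('a, 'c) ring_scheme"
    and M :: "('a, 'b, 'm) module_scheme"
    and \<alpha> :: "'o::wellorder"
    and \<Delta> :: "'i set"
    and N :: "'i \<Rightarrow> 'b set"
  assumes "right_module R M"
    and "weakly_atomic TYPE('o) R M"
    and "\<And>\<delta>. \<delta> \<in> \<Delta> \<Longrightarrow> submodule (N \<delta>) R M"
    and "irredundant_sum M \<Delta> N"
    and "\<And>\<delta>. \<delta> \<in> \<Delta> \<Longrightarrow> ndim_le R (sub_mod M (N \<delta>)) \<alpha>"
  shows "ndim_le R M \<alpha>"
proof -
  interpret right_module R M by (rule assms(1))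
  note N = assms(3)
  have sum: "carrier M = submodule_sum M \<Delta> N"
    and irred: "\<And>d. d \<in> \<Delta> \<Longrightarrow> carrier M \<noteq> submodule_sum M (\<Delta> - {d}) N"
    using assms(4) by (auto simp: irredundant_sum_def)
  show ?thesis
  proof (cases "\<Delta> = {}")
    case True
    then have "carrier M = {\<zero>\<^bsub>M\<^esub>}" using sum by (auto simp: submodule_sum_def)
    then show ?thesis by (simp add: ndim_le_iff)
  next
    case False
    then obtain d where d: "d \<in> \<Delta>" by blast
    let ?B = "submodule_sum M (\<Delta> - {d}) N"
    have B: "submodule ?B R M" using N by (intro submodule_submodule_sum) auto
    have "N d <+>\<^bsub>M\<^esub> ?B = carrier M"
      using submodule_sum_remove[of \<Delta> N d] N d sum submodule_set_add[OF N[OF d] B]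
      by (auto simp: submodule_iff)
    then have "N d = carrier M"
      using weakly_atomic_summand_trivial[OF assms(2) N[OF d] B] irred[OF d] by auto
    then show ?thesis using assms(5)[OF d] by (simp add: sub_mod_def)
  qed
qed

end
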